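(* In dynamic rings with chirality and cross detection, if the agents know either $n$ or $k$, then Gathering is solvable in at most $\mathcal{O}(n)$ rounds from any initial configuration $C\in\mathcal{C}\setminus\mathcal{P}$.
   Context: Dynamic ring. $\mathcal{R}=(v_0,\dots,v_{n-1})$ is a ring of $n$ anonymous nodes; $v_i$ is joined to $v_{i-1}$ and $v_{i+1}$ (indices modulo $n$) through two distinctly labeled ports $q_{i-}$, $q_{i+}$; the labeling is arbitrary and need not give a globally consistent orientation. Each port has an incoming and an outgoing buffer. Time proceeds in synchronous rounds; in each round an adversarial scheduler, not restricted by any fairness assumption, chooses which edge (at most one) is missing (1-interval connectivity). Agents. There are $k$ anonymous agents, each with its own memory and computational capability, all executing the same deterministic protocol. They start at distinct nodes, called homebases; homebases are identically marked, so an agent can tell whether its current node is a homebase. Several agents may be in the same node; an agent sees how many other agents are in its node and where (at the node, in which incoming or outgoing buffer). Agents have no explicit communication. Each agent has a private orientation of the ring, consistent over all nodes, designating at each node one port as left and the other as right. There is chirality if all agents agree on the orientation. There is cross detection if, whenever agents move in opposite directions on the same edge in the same round, the involved agents detect this event (not necessarily knowing how many agents are involved). Rounds. In each round each agent, based on the number of agents at its node and in the buffers, its memory and its state, chooses a direction in $\{left,right,nil\}$. With $nil$ it places itself at the node. Otherwise it moves to the outgoing buffer of the chosen port; if the edge is present, it arrives in the incoming buffer of the corresponding port of the neighbouring node in the next round; if the edge is missing it stays in the outgoing buffer. There is an initial state and a terminal state. Gathering. Gathering is achieved in a round if all agents are on the same node or on two neighbouring nodes. An algorithm solves Gathering from a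 configuration if, for every adversarial schedule and every admissible choice of port labels and private orientations, within finite time all agents are in the terminal state, are gathered, and are aware that gathering has been achieved. Configurations. A configuration is the set of locations of the $k$ homebases in the ring; $\mathcal{C}$ is the set of all configurations. Let $h_0,\dots,h_{k-1}$ be the homebases in clockwise order and $d_i$ the number of edges between $h_i$ and $h_{i+1}$ (indices modulo $k$). The configuration is periodic if there is $p$ with $p\mid k$, $p<k$, and $d_i=d_{i+p}$ for all $i$; $\mathcal{P}$ is the set of periodic configurations. *)

theory Defs
  imports Complex_Main "HOL-Library.Landau_Symbols"
begin

section \<open>The dynamic ring\<close>

text \<open>
  The nodes are the naturals below \<open>n\<close>; edge \<open>e < n\<close> joins \<open>e\<close> and \<open>(e + 1) mod n\<close>.
  The two ports of a node \<open>i\<close> are \<open>QMinus\<close> (towards \<open>i - 1\<close>) and \<open>QPlus\<close> (towards \<open>i + 1\<close>);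
  these are names used by the model only, agents never see them.
\<close>

datatype port = QMinus | QPlus

fun opposite :: "port \<Rightarrow> port" where
  "opposite QMinus = QPlus"
| "opposite QPlus = QMinus"

fun neighbour :: "nat \<Rightarrow> nat \<Rightarrow> port \<Rightarrow> nat" where
  "neighbour n i QPlus = (i + 1) mod n"
| "neighbour n i QMinus = (i + n - 1) mod n"

fun edge_at :: "nat \<Rightarrow> nat \<Rightarrow> port \<Rightarrow> nat" where
  "edge_at n i QPlus = i"
| "edge_at n i QMinus = (i + n - 1) mod n"

text \<open>\<open>sched t\<close> is the edge missing in round \<open>t\<close>, if any.\<close>

definition edge_schedule :: "nat \<Rightarrow> (nat \<Rightarrow> nat option) \<Rightarrow> bool" where
  "edge_schedule n sched \<longleftrightarrow> (\<forall>t e. sched t = Some e \<longrightarrow> e < n)"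

type_synonym labeling = "nat \<Rightarrow> port \<Rightarrow> nat"

definition port_labeling :: "nat \<Rightarrow> labeling \<Rightarrow> bool" where
  "port_labeling n lab \<longleftrightarrow> (\<forall>i<n. lab i QMinus \<noteq> lab i QPlus)"


section \<open>Private orientations\<close>

datatype hand = Left | Right

text \<open>An orientation designates, at each node, each of the two port labels as left or right.\<close>

type_synonym orientation = "nat \<Rightarrow> nat \<Rightarrow> hand"

definition private_orientation :: "nat \<Rightarrow> labeling \<Rightarrow> orientation \<Rightarrow> bool" where
  "private_orientation n lab ori \<longleftrightarrow>
     (\<forall>i<n. ori i (lab i QMinus) \<noteq> ori i (lab i QPlus)) \<and>
     (\<forall>i<n. \<forall>j<n. \<forall>q. ori i (lab i q) = ori j (lab j q))"

definition hand_of :: "labeling \<Rightarrow> orientation \<Rightarrow> nat \<Rightarrow> port \<Rightarrow> hand" where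
  "hand_of lab ori i q = ori i (lab i q)"

definition port_of :: "labeling \<Rightarrow> orientation \<Rightarrow> nat \<Rightarrow> hand \<Rightarrow> port" where
  "port_of lab ori i h = (if hand_of lab ori i QMinus = h then QMinus else QPlus)"

text \<open>Agents are named, in the model only, by their homebases; \<open>C\<close> is the set of homebases.\<close>

definition chirality :: "nat \<Rightarrow> nat set \<Rightarrow> labeling \<Rightarrow> (nat \<Rightarrow> orientation) \<Rightarrow> bool" where
  "chirality n C lab ori \<longleftrightarrow>
     (\<forall>a\<in>C. \<forall>b\<in>C. \<forall>i<n. \<forall>q. hand_of lab (ori a) i q = hand_of lab (ori b) i q)"


section \<open>Agents and protocols\<close>

text \<open>
  Where within its node an agent is: at the node itself or in a buffer of one of the ports,
  which are given by \<open>port\<close> in the model and by \<open>hand\<close> in what an agent perceives.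
\<close>

datatype 'p spot = AtNode | Incoming 'p | Outgoing 'p

record observation =
  on_homebase :: bool
  own_spot :: "hand spot"
  others :: "hand spot \<Rightarrow> nat"
  cross_detected :: bool

text \<open>
  The initial state may depend on one natural number, the value that the agents know.
  A chosen direction is \<open>Some Left\<close>, \<open>Some Right\<close> or \<open>None\<close> (for \<^emph>\<open>nil\<close>).
\<close>

record 's protocol =
  initial :: "nat \<Rightarrow> 's"
  terminal :: 's
  transition :: "'s \<Rightarrow> observation \<Rightarrow> 's \<times> hand option"

text \<open>\<open>crossed\<close>: in the previous round the agent crossed an agent moving the opposite way.\<close>

record 's agent =
  node :: nat
  spot :: "port spot"
  crossed :: bool
  state :: 's

definition observe ::
  "nat set \<Rightarrow> labeling \<Rightarrow> (nat \<Rightarrow> orientation) \<Rightarrow> (nat \<Rightarrow> 's agent) \<Rightarrow> nat \<Rightarrow> observation" where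
  "observe C lab ori cfg a =
     \<lparr> on_homebase = (node (cfg a) \<in> C),
       own_spot = map_spot (hand_of lab (ori a) (node (cfg a))) (spot (cfg a)),
       others = (\<lambda>x. card {b \<in> C. b \<noteq> a \<and> node (cfg b) = node (cfg a) \<and>
                        map_spot (hand_of lab (ori a) (node (cfg a))) (spot (cfg b)) = x}),
       cross_detected = crossed (cfg a) \<rparr>"


section \<open>Execution\<close>

text \<open>An agent in the terminal state no longer changes state or moves.\<close>

definition decision ::
  "'s protocol \<Rightarrow> nat set \<Rightarrow> labeling \<Rightarrow> (nat \<Rightarrow> orientation) \<Rightarrow> (nat \<Rightarrow> 's agent) \<Rightarrow> nat
     \<Rightarrow> 's \<times> hand option" where
  "decision P C lab ori cfg a =
     (if state (cfg a) = terminal P then (terminal P, None)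
      else transition P (state (cfg a)) (observe C lab ori cfg a))"

definition chosen_port ::
  "'s protocol \<Rightarrow> nat set \<Rightarrow> labeling \<Rightarrow> (nat \<Rightarrow> orientation) \<Rightarrow> (nat \<Rightarrow> 's agent) \<Rightarrow> nat
     \<Rightarrow> port option" where
  "chosen_port P C lab ori cfg a =
     map_option (port_of lab (ori a) (node (cfg a))) (snd (decision P C lab ori cfg a))"

text \<open>Agent \<open>a\<close> leaves its node through port \<open>q\<close> in a round in which \<open>missing\<close> is missing.\<close>

definition leaves ::
  "'s protocol \<Rightarrow> nat \<Rightarrow> nat set \<Rightarrow> labeling \<Rightarrow> (nat \<Rightarrow> orientation) \<Rightarrow> nat option
     \<Rightarrow> (nat \<Rightarrow> 's agent) \<Rightarrow> nat \<Rightarrow> port \<Rightarrow> bool" where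
  "leaves P n C lab ori missing cfg a q \<longleftrightarrow>
     chosen_port P C lab ori cfg a = Some q \<and> missing \<noteq> Some (edge_at n (node (cfg a)) q)"

definition step ::
  "'s protocol \<Rightarrow> nat \<Rightarrow> nat set \<Rightarrow> labeling \<Rightarrow> (nat \<Rightarrow> orientation) \<Rightarrow> nat option
     \<Rightarrow> (nat \<Rightarrow> 's agent) \<Rightarrow> nat \<Rightarrow> 's agent" where
  "step P n C lab ori missing cfg a =
     (let v = node (cfg a); s = fst (decision P C lab ori cfg a) in
      case chosen_port P C lab ori cfg a of
        None \<Rightarrow> \<lparr> node = v, spot = AtNode, crossed = False, state = s \<rparr>
      | Some q \<Rightarrow>
          if leaves P n C lab ori missing cfg a q
          then \<lparr> node = neighbour n v q, spot = Incoming (opposite q),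
                 crossed = (\<exists>b\<in>C. leaves P n C lab ori missing cfg b (opposite q) \<and>
                              edge_at n (node (cfg b)) (opposite q) = edge_at n v q),
                 state = s \<rparr>
          else \<lparr> node = v, spot = Outgoing q, crossed = False, state = s \<rparr>)"

text \<open>
  \<open>run P x n C lab ori sched t\<close> is the situation at the beginning of round \<open>t\<close>, when the
  agents know the value \<open>x\<close>.
\<close>

primrec run ::
  "'s protocol \<Rightarrow> nat \<Rightarrow> nat \<Rightarrow> nat set \<Rightarrow> labeling \<Rightarrow> (nat \<Rightarrow> orientation)
     \<Rightarrow> (nat \<Rightarrow> nat option) \<Rightarrow> nat \<Rightarrow> nat \<Rightarrow> 's agent" where
  "run P x n C lab ori sched 0 =
     (\<lambda>a. \<lparr> node = a, spot = AtNode, crossed = False, state = initial P x \<rparr>)"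
| "run P x n C lab ori sched (Suc t) =
     step P n C lab ori (sched t) (run P x n C lab ori sched t)"


section \<open>Gathering\<close>

definition gathered :: "nat \<Rightarrow> nat set \<Rightarrow> (nat \<Rightarrow> 's agent) \<Rightarrow> bool" where
  "gathered n C cfg \<longleftrightarrow> (\<exists>v<n. \<forall>a\<in>C. node (cfg a) = v \<or> node (cfg a) = (v + 1) mod n)"

text \<open>
  The last conjunct expresses awareness: an agent is in the terminal state only when
  gathering has been achieved.
\<close>

definition achieves_gathering_within ::
  "'s protocol \<Rightarrow> nat \<Rightarrow> nat set \<Rightarrow> (nat \<Rightarrow> nat \<Rightarrow> 's agent) \<Rightarrow> nat \<Rightarrow> bool" where
  "achieves_gathering_within P n C \<rho> T \<longleftrightarrow>
     (\<exists>r\<le>T. (\<forall>a\<in>C. state (\<rho> r a) = terminal P) \<and> gathered n C (\<rho> r)) \<and>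
     (\<forall>t. \<forall>a\<in>C. state (\<rho> t a) = terminal P \<longrightarrow> gathered n C (\<rho> t))"

text \<open>Chirality is assumed here; cross detection is built into \<open>observe\<close>.\<close>

definition solves_gathering_chirality_cross ::
  "'s protocol \<Rightarrow> nat \<Rightarrow> nat \<Rightarrow> nat set \<Rightarrow> nat \<Rightarrow> bool" where
  "solves_gathering_chirality_cross P x n C T \<longleftrightarrow>
     (\<forall>lab ori sched.
        port_labeling n lab \<and> (\<forall>a\<in>C. private_orientation n lab (ori a)) \<and>
        chirality n C lab ori \<and> edge_schedule n sched \<longrightarrow>
        achieves_gathering_within P n C (run P x n C lab ori sched) T)"


section \<open>Configurations\<close>

definition configurations :: "nat \<Rightarrow> nat \<Rightarrow> nat set set" where
  "configurations n k = {C. C \<subseteq> {..<n} \<and> card C = k}"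

definition homebase :: "nat set \<Rightarrow> nat \<Rightarrow> nat" where
  "homebase C i = sorted_list_of_set C ! i"

text \<open>Number of edges from the \<open>i\<close>-th homebase clockwise to the next one, for \<open>i < card C\<close>.\<close>

definition gap :: "nat \<Rightarrow> nat set \<Rightarrow> nat \<Rightarrow> nat" where
  "gap n C i =
     (if i + 1 < card C then homebase C (i + 1) - homebase C i
      else n + homebase C 0 - homebase C i)"

definition periodic_configurations :: "nat \<Rightarrow> nat \<Rightarrow> nat set set" where
  "periodic_configurations n k =
     {C \<in> configurations n k.
        \<exists>p. p dvd k \<and> p < k \<and> (\<forall>i<k. gap n C i = gap n C ((i + p) mod k))}"

end

theory Submission
  imports Defs "HOL-Library.Countable"
begin

text \<open>
  During the first \<open>3 n\<close> rounds all agents move left. At most one node is blocked in a round and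
  agents cannot overtake each other, so either all of them end on one node, or each of them has
  made at least \<open>n\<close> moves and has seen the whole ring. In the latter case the agents elect a node,
  which is possible because the configuration is not periodic. They keep moving left until round
  \<open>5 n\<close>, but wait at the elected node. Two agents that miss it and are on different nodes
  would together make \<open>2 n\<close> moves, although fewer than \<open>n\<close> moves lead to the elected node; hence
  at most two groups remain, one of them at the elected node. That group turns round and the two
  groups approach each other. In each round their distance shrinks unless they push against
  the two ends of the same missing edge. Hence by round \<open>6 n\<close> they have met, or crossed, which they
  detect, or are adjacent, and in the last case the clock tells them so.
\<close>

section \<open>Rotation invariant configurations\<close>

text \<open>Rotation by \<open>s\<close> permutes the homebases and keeps their cyclic order, hence
  shifts their indices by some \<open>q\<close>. The gaps then have the periods \<open>q\<close> and
  \<open>k\<close>, and so \<open>gcd q k\<close>.\<close>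

lemma rotation_invariant_imp_periodic:
  assumes C: "C \<in> configurations n k" and k: "1 \<le> k" and s: "0 < s" "s < n"
    and inv: "\<And>v. v < n \<Longrightarrow> (v + s) mod n \<in> C \<longleftrightarrow> v \<in> C"
  shows "C \<in> periodic_configurations n k"
proof -
  have Cn: "C \<subseteq> {..<n}" and card: "card C = k" using C by (auto simp: configurations_def)
  have fin: "finite C" using Cn finite_subset by blast
  have hb_less: "homebase C i < homebase C j" if "i < j" "j < k" for i j
    using that sorted_wrt_nth_less[OF strict_sorted_list_of_set[of C]] card
    by (simp add: homebase_def)
  have hb_image: "homebase C ` {..<k} = C"
  proof -
    have "C = set (sorted_list_of_set C)" using fin by simp
    also have "\<dots> = homebase C ` {..<k}" unfolding set_conv_nth homebase_def using card by auto
    finally show ?thesis by simp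
  qed
  have hb_mem: "homebase C i \<in> C" if "i < k" for i using hb_image that by blast
  have hb_lt: "homebase C i < n" if "i < k" for i using hb_mem[OF that] Cn by blast
  define G where "G i = gap n C (i mod k)" for i
  \<comment> \<open>\<open>E\<close> enumerates increasingly all naturals whose residue modulo
    \<open>n\<close> is a homebase, so that no wrap-around remains.\<close>
  define E where "E i = homebase C (i mod k) + n * (i div k)" for i
  have E_Suc: "E (Suc i) = E i + G i" and G_pos: "0 < G i" for i
  proof -
    have ik: "i mod k < k" using k by simp
    consider "Suc (i mod k) < k" | "Suc (i mod k) = k" using ik by linarith
    then have "E (Suc i) = E i + G i \<and> 0 < G i"
    proof cases
      case 1
      then have "Suc i mod k = Suc (i mod k)" "Suc i div k = i div k"
        by (simp_all add: mod_Suc div_Suc)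
      then show ?thesis
        using hb_less[of "i mod k" "Suc (i mod k)"] 1 card by (simp add: E_def G_def gap_def)
    next
      case 2
      then have "Suc i mod k = 0" "Suc i div k = Suc (i div k)"
        by (simp_all add: mod_Suc div_Suc)
      then show ?thesis
        using hb_lt[OF ik] 2 card by (simp add: E_def G_def gap_def)
    qed
    then show "E (Suc i) = E i + G i" "0 < G i" by auto
  qed
  have mono: "strict_mono E"
    by (rule strict_mono_Suc_iff[THEN iffD2]) (use E_Suc G_pos in simp)
  have E_less: "E i < E j \<longleftrightarrow> i < j" for i j using mono by (simp add: strict_mono_less)
  have n: "0 < n" using s by simp
  have E_range: "v \<in> range E \<longleftrightarrow> v mod n \<in> C" for v
  proof
    assume "v \<in> range E"
    then obtain i where "v = E i" by blast
    then have "v mod n = homebase C (i mod k)" using hb_lt[of "i mod k"] k by (simp add: E_def)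
    then show "v mod n \<in> C" using hb_mem[of "i mod k"] k by simp
  next
    assume "v mod n \<in> C"
    then obtain j where j: "j < k" "v mod n = homebase C j" using hb_image by blast
    have "E (j + k * (v div n)) = v" using j by (simp add: E_def flip: j(2))
    then show "v \<in> range E" by (metis rangeI)
  qed
  have shift: "v + s \<in> range E \<longleftrightarrow> v \<in> range E" for v
    using inv[of "v mod n"] n by (simp add: E_range mod_simps)
  obtain q where q: "E 0 + s = E q" using shift[of "E 0"] by blast
  have shifted: "E i + s = E (i + q)" for i
  proof (induction i)
    case 0
    then show ?case using q by simp
  next
    case (Suc i)
    obtain j where j: "E (Suc i) + s = E j" using shift[of "E (Suc i)"] by blast
    have "E (i + q) < E j" using Suc j E_less[of i "Suc i"] by linarith
    then have ge: "Suc (i + q) \<le> j" using E_less by simp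
    \<comment> \<open>An element of \<open>range E\<close> strictly between \<open>E (i + q)\<close>
      and \<open>E j\<close> would shift back to one strictly between \<open>E i\<close> and
      \<open>E (Suc i)\<close>.\<close>
    have "\<not> Suc (i + q) < j"
    proof
      assume "Suc (i + q) < j"
      then have lt: "E (i + q) < E (Suc (i + q))" "E (Suc (i + q)) < E j"
        using E_less by simp_all
      then have "E (Suc (i + q)) - s + s \<in> range E" using Suc by simp
      then obtain l where "E l = E (Suc (i + q)) - s" using shift by (metis imageE)
      then have "E i < E l" "E l < E (Suc i)" using lt Suc j by linarith+
      then show False using E_less by simp
    qed
    then show ?case using j ge by (metis add_Suc le_neq_implies_less)
  qed
  have G_q: "G (i + q) = G i" for i
    using shifted[of i] shifted[of "Suc i"] E_Suc[of i] E_Suc[of "i + q"] by simp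
  have q0: "0 < q" using E_less[of 0 q] q s by simp
  \<comment> \<open>One turn around the ring is \<open>k\<close> indices long and has length
    \<open>n\<close>. As \<open>s < n\<close>, this gives \<open>q < k\<close>, so
    \<open>gcd q k\<close> is a proper divisor.\<close>
  have "E k = E 0 + n" using k by (simp add: E_def)
  then have qk: "q < k" using E_less[of q k] q s by simp
  have G_qu: "G (i + q * u) = G i" for i u
    by (induction u) (use G_q in \<open>simp_all add: add.assoc[symmetric] add.commute[of q]\<close>)
  obtain u v where uv: "q * u = k * v + gcd q k" using bezout_nat[of q k] q0 by blast
  have "G (i + gcd q k) = G i" for i
  proof -
    have "G i = G (i + gcd q k + k * v)" using G_qu[of i u] uv by (simp add: ac_simps)
    then show ?thesis by (simp add: G_def)
  qed
  moreover have "gcd q k < k" using gcd_le1_nat[of q k] q0 qk by linarith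
  ultimately show ?thesis
    using C unfolding periodic_configurations_def G_def
    by (auto intro!: exI[of _ "gcd q k"])
qed

section \<open>The protocol\<close>

text \<open>Gives finiteness of the type over which \<open>agents_here\<close> sums.\<close>

lemma UNIV_hand_spot:
  "(UNIV :: hand spot set) =
     {AtNode, Incoming Left, Incoming Right, Outgoing Left, Outgoing Right}"
proof -
  have "h \<in> {AtNode, Incoming Left, Incoming Right, Outgoing Left, Outgoing Right}"
    for h :: "hand spot"
  proof (cases h)
    case (Incoming x)
    then show ?thesis by (cases x) auto
  next
    case (Outgoing x)
    then show ?thesis by (cases x) auto
  qed simp
  then show ?thesis by blast
qed

text \<open>
  An agent logs, for every node reached by a move to the left, whether it is a homebase. It has
  completed a tour of the ring, and knows the configuration, once the extent of its log reaches the
  known value: a log that starts at a homebase contains \<open>k\<close> homebases only after \<open>n\<close> moves.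
\<close>

definition extent :: "bool \<Rightarrow> bool list \<Rightarrow> nat" where
  "extent knows_n H = (if knows_n then length H else count_list H True)"

definition learnt_size :: "bool \<Rightarrow> nat \<Rightarrow> bool list \<Rightarrow> nat" where
  "learnt_size knows_n x H = (LEAST j. extent knows_n (take j H) = x)"

text \<open>
  The tours logged by different agents are rotations of each other, so all agents elect the same
  rotation. It determines a single node because the configuration is not periodic.
\<close>

definition at_target :: "nat \<Rightarrow> bool list \<Rightarrow> bool" where
  "at_target n H \<longleftrightarrow>
     (\<forall>i<n. to_nat (rotate (length H) (take n H)) \<le> to_nat (rotate i (take n H)))"

text \<open>
  When \<open>n\<close> is known, an agent without a complete tour in round \<open>3 n\<close> concludes that all agents are
  on its node. Meetings are ignored before, since an agent may not yet know \<open>k\<close>. The value of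
  \<open>learnt_size\<close> is meaningful only after a tour.
\<close>

definition stops :: "bool \<Rightarrow> nat \<Rightarrow> nat \<Rightarrow> bool list \<Rightarrow> nat \<Rightarrow> bool \<Rightarrow> bool" where
  "stops knows_n x t H c cross \<longleftrightarrow>
     (let n = learnt_size knows_n x H in
      \<not> knows_n \<and> c = x \<or>
      (if extent knows_n H < x then knows_n \<and> 3 * x \<le> t
       else 3 * n \<le> t \<and> c = count_list (take n H) True \<or> 5 * n < t \<and> cross \<or> 6 * n \<le> t))"

definition heading :: "bool \<Rightarrow> nat \<Rightarrow> nat \<Rightarrow> bool list \<Rightarrow> hand option" where
  "heading knows_n x t H =
     (let n = learnt_size knows_n x H in
      if x \<le> extent knows_n H \<and> 3 * n \<le> t \<and> at_target n H
      then if t < 5 * n then None else Some Right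
      else Some Left)"

text \<open>
  Arriving through the right port means having moved left. Moves to the right are not logged, so an
  agent that waited at the target remembers this when it turns round.
\<close>

definition extended_log :: "bool list \<Rightarrow> observation \<Rightarrow> bool list" where
  "extended_log H obs = (if own_spot obs = Incoming Right then H @ [on_homebase obs] else H)"

definition agents_here :: "observation \<Rightarrow> nat" where
  "agents_here obs = Suc (\<Sum>h\<in>UNIV. others obs h)"

text \<open>States are codes of triples: known value, clock, log. The value is stored because
  transitions do not receive it; the clocks agree since all agents start together.\<close>

definition gathering_protocol :: "bool \<Rightarrow> nat protocol" where
  "gathering_protocol knows_n =
     \<lparr> initial = (\<lambda>x. to_nat (Some (x, 0 :: nat, [] :: bool list))),
       terminal = to_nat (None :: (nat \<times> nat \<times> bool list) option),
       transition = (\<lambda>s obs.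
         case from_nat s of
           None \<Rightarrow> (s, None)
         | Some (x :: nat, t :: nat, H :: bool list) \<Rightarrow>
             let H' = extended_log H obs in
             if stops knows_n x t H' (agents_here obs) (cross_detected obs)
             then (to_nat (None :: (nat \<times> nat \<times> bool list) option), None)
             else (to_nat (Some (x, Suc t, H')), heading knows_n x t H')) \<rparr>"

lemma count_list_map_upt: "count_list (map f [0..<m]) True = card {j \<in> {..<m}. f j}"
proof (induction m)
  case (Suc m)
  have "{j \<in> {..<Suc m}. f j} = (if f m then insert m {j \<in> {..<m}. f j} else {j \<in> {..<m}. f j})"
    by (auto simp: less_Suc_eq)
  then show ?case using Suc by auto
qed simp

section \<open>The unrolled ring and the elected node\<close>

text \<open>Chirality and consistency of the orientations are condensed into one port
  \<open>L\<close> that every agent calls left at every node.\<close>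

locale ring_execution =
  fixes knows_n :: bool and n k :: nat and C :: "nat set" and L :: port
    and lab :: labeling and ori :: "nat \<Rightarrow> orientation" and sched :: "nat \<Rightarrow> nat option"
  assumes k: "1 \<le> k" and C: "C \<in> configurations n k - periodic_configurations n k"
    and hand: "\<And>a i q. a \<in> C \<Longrightarrow> i < n \<Longrightarrow>
      hand_of lab (ori a) i q = (if q = L then Left else Right)"
begin

lemma C_sub: "C \<subseteq> {..<n}" and card_C: "card C = k" and fin_C: "finite C"
  using C finite_subset[of C "{..<n}"] by (auto simp: configurations_def)

lemma C_nonempty: "C \<noteq> {}"
  using k card_C by auto

lemma n_pos: "0 < n"
  using C_sub C_nonempty by (cases n) auto

text \<open>
  The ring is unrolled to the integers in such a way that \<open>+ 1\<close> is a move to the left, whichever of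
  the two ports that is. The edge \<open>link p\<close> joins \<open>loc p\<close> and \<open>loc (p + 1)\<close>.
\<close>

definition lift :: "nat \<Rightarrow> int" where
  "lift a = (if L = QPlus then int a else - int a)"

definition loc :: "int \<Rightarrow> nat" where
  "loc p = nat (lift 1 * p mod int n)"

definition link :: "int \<Rightarrow> nat" where
  "link p = edge_at n (loc p) L"

lemma lift_one: "lift 1 = 1 \<or> lift 1 = - 1"
  by (simp add: lift_def)

lemma int_loc: "int (loc p) = lift 1 * p mod int n"
  using n_pos by (simp add: loc_def)

lemma loc_less: "loc p < n"
  using n_pos int_loc[of p] by (metis of_nat_0_less_iff of_nat_less_iff pos_mod_bound)

lemma loc_eq_iff: "loc p = loc q \<longleftrightarrow> int n dvd p - q"
proof -
  have "loc p = loc q \<longleftrightarrow> int n dvd lift 1 * (p - q)"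
    by (metis int_loc of_nat_eq_iff mod_eq_dvd_iff right_diff_distrib)
  then show ?thesis using lift_one by (metis dvd_minus_iff mult_1 mult_minus1)
qed

lemma loc_lift: "a < n \<Longrightarrow> loc (lift a) = a"
  by (simp add: loc_def lift_def)

lemma int_neighbour:
  "int (neighbour n v q) = (int v + (if q = QPlus then 1 else - 1)) mod int n"
proof (cases q)
  case QPlus
  then show ?thesis by (simp add: zmod_int add.commute)
next
  case QMinus
  have "int (v + n - 1) = int v - 1 + int n" using n_pos by linarith
  then show ?thesis using QMinus by (simp add: zmod_int del: One_nat_def)
qed

lemma neighbour_left: "neighbour n (loc p) L = loc (p + 1)"
proof -
  have "int (neighbour n (loc p) L) = int (loc (p + 1))"
    unfolding int_neighbour int_loc mod_simps by (simp add: lift_def algebra_simps)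
  then show ?thesis by simp
qed

lemma neighbour_right: "neighbour n (loc p) (opposite L) = loc (p - 1)"
proof -
  have "opposite L = QPlus \<longleftrightarrow> L \<noteq> QPlus" by (cases L) auto
  then have "int (neighbour n (loc p) (opposite L)) = int (loc (p - 1))"
    unfolding int_neighbour int_loc mod_simps by (simp add: lift_def algebra_simps)
  then show ?thesis by simp
qed

lemma edge_at_eq: "edge_at n v q = (if q = QPlus then v else neighbour n v q)"
  by (cases q) auto

lemma link_eq: "link p = loc (p + (if L = QPlus then 0 else 1))"
  unfolding link_def edge_at_eq neighbour_left by simp

lemma link_right: "edge_at n (loc p) (opposite L) = link (p - 1)"
proof -
  have "opposite L = QPlus \<longleftrightarrow> L \<noteq> QPlus" by (cases L) auto
  then show ?thesis unfolding link_eq edge_at_eq neighbour_right by simp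
qed

lemma link_eq_iff: "link p = link q \<longleftrightarrow> int n dvd p - q"
  unfolding link_eq loc_eq_iff by simp

lemma residue_offset:
  obtains i where "i < n" "int n dvd (p + int i) - q"
proof
  show "nat ((q - p) mod int n) < n" using n_pos by (simp add: nat_less_iff)
  have "int n dvd (q - p) mod int n - (q - p)" by (simp flip: mod_eq_dvd_iff)
  then show "int n dvd (p + int (nat ((q - p) mod int n))) - q"
    using n_pos by (simp add: algebra_simps)
qed

text \<open>The log of \<open>m\<close> left moves from \<open>p\<close>. It begins with
  \<open>p + 1\<close>, so the starting node is the last entry of a full tour.\<close>

definition view :: "int \<Rightarrow> nat \<Rightarrow> bool list" where
  "view p m = map (\<lambda>j. loc (p + 1 + int j) \<in> C) [0..<m]"

lemma view_0 [simp]: "view p 0 = []"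
  and view_Suc: "view p (Suc m) = view p m @ [loc (p + 1 + int m) \<in> C]"
  and length_view [simp]: "length (view p m) = m"
  by (simp_all add: view_def)

lemma take_view: "take j (view p m) = view p (min j m)"
  by (simp add: view_def take_map min_def)

lemma loc_cong: "int n dvd p - q \<Longrightarrow> loc (p + r) = loc (q + r)"
  by (simp add: loc_eq_iff)

lemma view_cong: "int n dvd p - q \<Longrightarrow> view p m = view q m"
  using loc_cong[of p q] by (simp add: view_def add.assoc)

lemma rotate_view: "rotate i (view p n) = view (p + int i) n"
proof (rule nth_equalityI)
  fix j assume "j < length (rotate i (view p n))"
  then have j: "j < n" by simp
  have "loc (p + 1 + int ((i + j) mod n)) = loc (p + int i + 1 + int j)"
    unfolding loc_eq_iff by (simp add: zmod_int algebra_simps mod_eq_dvd_iff[symmetric])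
  then show "rotate i (view p n) ! j = view (p + int i) n ! j"
    using j n_pos by (simp add: nth_rotate view_def)
qed simp

text \<open>Non-periodicity enters here: if two nodes had the same tour, \<open>C\<close> would be
  invariant under the rotation taking one to the other.\<close>

lemma view_inj:
  assumes eq: "view p n = view q n"
  shows "int n dvd p - q"
proof (rule ccontr)
  assume nd: "\<not> int n dvd p - q"
  have same: "loc (p + r) \<in> C \<longleftrightarrow> loc (q + r) \<in> C" for r
  proof -
    obtain j where j: "j < n" "int n dvd (1 + int j) - r" using residue_offset by blast
    have "view p n ! j = view q n ! j" using eq by simp
    then have "loc (p + (1 + int j)) \<in> C \<longleftrightarrow> loc (q + (1 + int j)) \<in> C"
      using j by (simp add: view_def add.assoc)
    moreover have "loc (y + (1 + int j)) = loc (y + r)" for y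
      using j(2) by (simp add: loc_eq_iff)
    ultimately show ?thesis by simp
  qed
  \<comment> \<open>Passing through \<open>loc\<close> expresses the shift in the clockwise
    numbering, whichever port \<open>L\<close> is.\<close>
  define s where "s = loc (p - q)"
  have "loc (p - q) \<noteq> loc 0" using nd by (simp add: loc_eq_iff)
  then have s: "0 < s" "s < n" using loc_less by (auto simp: s_def loc_def)
  have "(v + s) mod n \<in> C \<longleftrightarrow> v \<in> C" if "v < n" for v
  proof -
    have "int ((v + s) mod n) = int (loc (p + (lift v - q)))"
      by (simp add: s_def zmod_int int_loc mod_simps) (simp add: lift_def algebra_simps)
    then show ?thesis using same[of "lift v - q"] loc_lift[OF that] by simp
  qed
  then have "C \<in> periodic_configurations n k"
    using rotation_invariant_imp_periodic[of C n k s] C k s by blast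
  then show False using C by simp
qed

lemma count_view: "count_list (view p n) True = k"
proof -
  let ?f = "\<lambda>j. loc (p + 1 + int j)"
  have inj: "inj_on ?f {..<n}"
  proof (rule inj_onI)
    fix i j assume *: "i \<in> {..<n}" "j \<in> {..<n}" "?f i = ?f j"
    then have "int n dvd int i - int j" by (simp add: loc_eq_iff)
    then have "int i mod int n = int j mod int n" by (simp add: mod_eq_dvd_iff)
    then show "i = j" using * by simp
  qed
  have "?f ` {..<n} = {..<n}"
    using loc_less by (intro card_subset_eq) (auto simp: card_image[OF inj])
  then have "?f ` {j \<in> {..<n}. ?f j \<in> C} = C" using C_sub by auto
  moreover have "inj_on ?f {j \<in> {..<n}. ?f j \<in> C}" using inj by (rule inj_on_subset) auto
  ultimately show ?thesis
    unfolding view_def count_list_map_upt using card_image[of ?f "{j \<in> {..<n}. ?f j \<in> C}"] card_C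
    by simp
qed

section \<open>What an agent learns from its log\<close>

definition known_value :: nat where
  "known_value = (if knows_n then n else k)"

text \<open>The last entry of a full tour is the homebase where it began, so a shorter log misses at
  least one homebase.\<close>

lemma extent_less:
  assumes "a \<in> C" "m < n"
  shows "extent knows_n (view (lift a) m) < known_value"
proof -
  have "loc (lift a + 1 + int (n - 1)) = loc (lift a)"
    using n_pos by (simp add: loc_eq_iff of_nat_diff)
  then have "view (lift a) n = view (lift a) (n - 1) @ [True]"
    using view_Suc[of "lift a" "n - 1"] n_pos assms C_sub loc_lift[of a] by auto
  then have "count_list (view (lift a) (n - 1)) True < k"
    using count_view[of "lift a"] by simp
  moreover have "view (lift a) m = take m (view (lift a) (n - 1))"
    using assms by (simp add: take_view min_absorb1)
  then have "count_list (view (lift a) m) True \<le> count_list (view (lift a) (n - 1)) True"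
    by (metis append_take_drop_id count_list_append le_add1)
  ultimately show ?thesis using assms by (simp add: extent_def known_value_def)
qed

lemma extent_full: "extent knows_n (view p n) = known_value"
  by (simp add: extent_def known_value_def count_view)

lemma extent_ge:
  assumes "n \<le> m"
  shows "known_value \<le> extent knows_n (view p m)"
proof -
  have "take n (view p m) = view p n" using assms by (simp add: take_view min_def)
  then have "count_list (view p n) True \<le> count_list (view p m) True"
    by (metis append_take_drop_id count_list_append le_add1)
  then show ?thesis using assms by (simp add: extent_def known_value_def count_view)
qed

lemma learnt_size_view:
  assumes "a \<in> C" "n \<le> m"
  shows "learnt_size knows_n known_value (view (lift a) m) = n"
  unfolding learnt_size_def
proof (rule Least_equality)
  show "extent knows_n (take n (view (lift a) m)) = known_value"
    using assms extent_full by (simp add: take_view min_def)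
  fix j assume j: "extent knows_n (take j (view (lift a) m)) = known_value"
  show "n \<le> j"
  proof (rule ccontr)
    assume "\<not> n \<le> j"
    then show False using extent_less[OF assms(1), of j] j assms by (simp add: take_view min_absorb1)
  qed
qed

text \<open>Election by the least code of a tour. The elected node appears as a whole residue class
  of positions.\<close>

definition target :: "int \<Rightarrow> bool" where
  "target p \<longleftrightarrow> (\<forall>q. to_nat (view p n) \<le> to_nat (view q n))"

lemma target_ex: "\<exists>p. target p"
  unfolding target_def using ex_has_least_nat[of "\<lambda>_. True" 0 "\<lambda>p. to_nat (view p n)"] by simp

lemma target_unique: "target p \<Longrightarrow> target q \<Longrightarrow> int n dvd p - q"
  unfolding target_def by (metis view_inj antisym to_nat_split)

lemma target_cong: "int n dvd p - q \<Longrightarrow> target p \<longleftrightarrow> target q"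
  using view_cong by (simp add: target_def)

text \<open>Rotating the recorded tour by the length of the log gives the tour from the current
  position, and the rotations are the tours from all nodes.\<close>

lemma at_target_view:
  assumes "n \<le> m"
  shows "at_target n (view p m) \<longleftrightarrow> target (p + int m)"
proof -
  have tk: "take n (view p m) = view p n" using assms by (simp add: take_view min_def)
  have "\<exists>i<n. view q n = view (p + int i) n" for q
    using residue_offset[of p q] view_cong by metis
  then show ?thesis
    unfolding at_target_def target_def tk rotate_view length_view by metis
qed

section \<open>Moving left\<close>

text \<open>
  The successful moves to the left of agent \<open>a\<close>, as long as no agent has stopped and \<open>t \<le> 5 n\<close>.
\<close>

primrec moves :: "nat \<Rightarrow> nat \<Rightarrow> nat" where
  "moves 0 a = 0"
| "moves (Suc t) a = moves t a +
     (if 3 * n \<le> t \<and> target (lift a + int (moves t a)) \<or>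
         sched t = Some (link (lift a + int (moves t a))) then 0 else 1)"

definition pos :: "nat \<Rightarrow> nat \<Rightarrow> int" where
  "pos t a = lift a + int (moves t a)"

lemma pos_Suc:
  "pos (Suc t) a = pos t a +
     (if 3 * n \<le> t \<and> target (pos t a) \<or> sched t = Some (link (pos t a)) then 0 else 1)"
  by (simp add: pos_def)

lemma moves_Suc:
  "moves (Suc t) a = moves t a +
     (if 3 * n \<le> t \<and> target (pos t a) \<or> sched t = Some (link (pos t a)) then 0 else 1)"
  by (simp add: pos_def)

declare moves.simps(2) [simp del]

lemma moves_mono: "s \<le> t \<Longrightarrow> moves s a \<le> moves t a"
  by (rule lift_Suc_mono_le[of "\<lambda>t. moves t a"]) (auto simp: moves_Suc)

text \<open>Agents on one node are blocked, or wait, together: groups never split.\<close>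

lemma pos_dvd_Suc:
  assumes "int n dvd pos t a - pos t b"
  shows "pos (Suc t) a - pos (Suc t) b = pos t a - pos t b"
proof -
  have "link (pos t a) = link (pos t b)" "target (pos t a) = target (pos t b)"
    using assms link_eq_iff target_cong by blast+
  then show ?thesis by (simp add: pos_Suc)
qed

lemma lift_diff_less: "a \<in> C \<Longrightarrow> b \<in> C \<Longrightarrow> \<bar>lift a - lift b\<bar> < int n"
  using C_sub[THEN subsetD, of a] C_sub[THEN subsetD, of b] by (auto simp: lift_def)

text \<open>Neither agent overtakes the other, not even by a full turn, since a meeting is
  permanent. While apart they face different edges, so at most one of them is blocked per
  round.\<close>

lemma first_stage:
  assumes "a \<in> C" "b \<in> C" "lift a \<le> lift b" "t \<le> 3 * n"
  shows "pos t a \<le> pos t b \<and> pos t b \<le> pos t a + int n \<and>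
     (\<not> int n dvd pos t a - pos t b \<longrightarrow> t \<le> moves t a + moves t b)"
  using assms(4)
proof (induction t)
  case 0
  then show ?case using lift_diff_less[OF assms(1,2)] assms(3) by (simp add: pos_def)
next
  case (Suc t)
  then have IH: "pos t a \<le> pos t b" "pos t b \<le> pos t a + int n"
    "\<not> int n dvd pos t a - pos t b \<Longrightarrow> t \<le> moves t a + moves t b"
    and t: "\<not> 3 * n \<le> t" by auto
  show ?case
  proof (cases "int n dvd pos t a - pos t b")
    case True
    then show ?thesis using pos_dvd_Suc[OF True] IH True by auto
  next
    case False
    then have "pos t a \<noteq> pos t b" "pos t b \<noteq> pos t a + int n" by auto
    moreover have "link (pos t a) \<noteq> link (pos t b)" using False link_eq_iff by simp
    ultimately show ?thesis using IH(1,2) IH(3)[OF False] t by (auto simp: pos_Suc moves_Suc)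
  qed
qed

text \<open>The two counts sum to at least \<open>3 * n\<close>. They differ by less than
  \<open>n\<close>, because the distances at the start and now, taken in the same order, both lie
  between 0 and \<open>n\<close>. So the smaller count is at least \<open>n\<close>.\<close>

lemma tour_pair:
  assumes "a \<in> C" "b \<in> C" "\<not> int n dvd pos (3 * n) a - pos (3 * n) b"
  shows "n \<le> moves (3 * n) a \<and> n \<le> moves (3 * n) b"
proof -
  have *: "n \<le> moves (3 * n) a \<and> n \<le> moves (3 * n) b"
    if "a \<in> C" "b \<in> C" "\<not> int n dvd pos (3 * n) a - pos (3 * n) b" "lift a \<le> lift b" for a b
  proof -
    have "pos (3 * n) a \<noteq> pos (3 * n) b" "pos (3 * n) b \<noteq> pos (3 * n) a + int n"
      using that(3) by auto
    then show ?thesis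
      using first_stage[OF that(1,2,4), of "3 * n"] that(3,4) lift_diff_less[OF that(1,2)]
      by (simp add: pos_def)
  qed
  have "\<not> int n dvd pos (3 * n) b - pos (3 * n) a"
    using assms(3) by (simp add: dvd_diff_commute)
  then show ?thesis using *[of a b] *[of b a] assms by linarith
qed

definition colocated :: "nat \<Rightarrow> bool" where
  "colocated t \<longleftrightarrow> (\<forall>a\<in>C. \<forall>b\<in>C. loc (pos t a) = loc (pos t b))"

text \<open>Any agent is apart from at least one of two agents that are apart, so the argument for
  pairs reaches everyone.\<close>

lemma tour:
  assumes nc: "\<not> colocated (3 * n)" and a: "a \<in> C" and t: "3 * n \<le> t"
  shows "n \<le> moves t a"
proof -
  obtain b c where bc: "b \<in> C" "c \<in> C" "\<not> int n dvd pos (3 * n) b - pos (3 * n) c"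
    using nc by (auto simp: colocated_def loc_eq_iff)
  have "\<not> int n dvd pos (3 * n) a - pos (3 * n) b \<or> \<not> int n dvd pos (3 * n) a - pos (3 * n) c"
    using bc(3) by (metis loc_eq_iff)
  then have "n \<le> moves (3 * n) a" using tour_pair a bc by blast
  then show ?thesis using moves_mono[OF t, of a] by simp
qed

text \<open>From round \<open>3 * n\<close> on, an agent at the target stays there, so one that is
  still off target has passed only other nodes.\<close>

lemma searched:
  assumes "\<not> target (pos (3 * n + s) a)" "j \<le> moves (3 * n + s) a - moves (3 * n) a"
  shows "\<not> target (pos (3 * n + s) a - int j)"
  using assms
proof (induction s arbitrary: j)
  case (Suc s)
  let ?t = "3 * n + s"
  have nt: "\<not> target (pos ?t a)" using Suc.prems(1) by (auto simp: pos_Suc)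
  have mono: "moves (3 * n) a \<le> moves ?t a" by (simp add: moves_mono)
  show ?case
  proof (cases "sched ?t = Some (link (pos ?t a))")
    case True
    then show ?thesis using Suc.IH[OF nt, of j] Suc.prems(2) by (simp add: pos_Suc moves_Suc)
  next
    case False
    then have *: "pos (3 * n + Suc s) a = pos ?t a + 1"
      "moves (3 * n + Suc s) a = moves ?t a + 1" using nt by (simp_all add: pos_Suc moves_Suc)
    show ?thesis
    proof (cases j)
      case 0
      then show ?thesis using Suc.prems(1) by simp
    next
      case (Suc i)
      then show ?thesis using Suc.IH[OF nt, of i] Suc.prems(2) * mono by simp
    qed
  qed
qed simp

text \<open>Any \<open>n\<close> consecutive positions include the elected node.\<close>

lemma short_search:
  assumes "\<not> target (pos (3 * n + s) a)"
  shows "moves (3 * n + s) a < moves (3 * n) a + n"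
proof (rule ccontr)
  assume "\<not> moves (3 * n + s) a < moves (3 * n) a + n"
  moreover obtain p where p: "target p" using target_ex by blast
  obtain j where j: "j < n" "int n dvd (p + int j) - pos (3 * n + s) a"
    using residue_offset by blast
  have "int n dvd p - (pos (3 * n + s) a - int j)" using j(2) by (simp add: algebra_simps)
  then have "target (pos (3 * n + s) a - int j)" using p target_cong by blast
  ultimately show False using searched[OF assms, of j] j(1) by linarith
qed

text \<open>As in \<open>first_stage\<close>, two searching agents that are apart are never blocked
  in the same round.\<close>

lemma second_stage:
  assumes "\<not> target (pos (3 * n + s) a)" "\<not> target (pos (3 * n + s) b)"
    "\<not> int n dvd pos (3 * n + s) a - pos (3 * n + s) b"
  shows "s + moves (3 * n) a + moves (3 * n) b \<le> moves (3 * n + s) a + moves (3 * n + s) b"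
  using assms
proof (induction s)
  case (Suc s)
  let ?t = "3 * n + s"
  have nt: "\<not> target (pos ?t a)" "\<not> target (pos ?t b)" using Suc.prems by (auto simp: pos_Suc)
  have nd: "\<not> int n dvd pos ?t a - pos ?t b" using pos_dvd_Suc[of ?t a b] Suc.prems(3) by auto
  then have "link (pos ?t a) \<noteq> link (pos ?t b)" by (simp add: link_eq_iff)
  then show ?case using Suc.IH[OF nt nd] nt by (auto simp: moves_Suc)
qed simp

text \<open>Otherwise \<open>2 * n\<close> rounds would yield at least \<open>2 * n\<close> moves by
  \<open>second_stage\<close>, but each agent makes fewer than \<open>n\<close> by
  \<open>short_search\<close>.\<close>

lemma two_groups:
  assumes "\<not> target (pos (5 * n) a)" "\<not> target (pos (5 * n) b)"
  shows "int n dvd pos (5 * n) a - pos (5 * n) b"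
proof (rule ccontr)
  assume nd: "\<not> int n dvd pos (5 * n) a - pos (5 * n) b"
  have five: "5 * n = 3 * n + 2 * n" by simp
  show False
    using short_search[of "2 * n" a] short_search[of "2 * n" b] second_stage[of "2 * n" a b]
      nd assms n_pos unfolding five by linarith
qed

section \<open>Executions up to round 5 n\<close>

abbreviation (input) live :: "nat \<Rightarrow> bool list \<Rightarrow> nat" where
  "live t H \<equiv> to_nat (Some (known_value, t, H))"

abbreviation (input) over :: nat where
  "over \<equiv> to_nat (None :: (nat \<times> nat \<times> bool list) option)"

abbreviation P :: "nat protocol" where
  "P \<equiv> gathering_protocol knows_n"

text \<open>The stored log lacks the current observation, hence \<open>extended_log\<close>.
  Position \<open>p\<close> and log length \<open>m\<close> are kept apart because moves to the
  right change only \<open>p\<close>.\<close>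

definition tracks :: "nat \<Rightarrow> (nat \<Rightarrow> nat agent) \<Rightarrow> nat \<Rightarrow> int \<Rightarrow> nat \<Rightarrow> bool" where
  "tracks t cfg a p m \<longleftrightarrow> node (cfg a) = loc p \<and>
     (\<exists>H. state (cfg a) = live t H \<and>
          extended_log H (observe C lab ori cfg a) = view (lift a) m)"

text \<open>The other agents on the node are partitioned by the spot at which they are seen.\<close>

lemma agents_here_observe:
  assumes "a \<in> C"
  shows "agents_here (observe C lab ori cfg a) = card {b \<in> C. node (cfg b) = node (cfg a)}"
proof -
  let ?B = "{b \<in> C. b \<noteq> a \<and> node (cfg b) = node (cfg a)}"
  let ?g = "\<lambda>b. map_spot (hand_of lab (ori a) (node (cfg a))) (spot (cfg b))"
  have fin: "finite (UNIV :: hand spot set)" by (simp add: UNIV_hand_spot)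
  have "(\<Sum>h\<in>UNIV. others (observe C lab ori cfg a) h) = (\<Sum>h\<in>UNIV. card {b \<in> ?B. ?g b = h})"
    by (auto simp: observe_def intro!: sum.cong arg_cong[of _ _ card])
  also have "\<dots> = (\<Sum>h\<in>UNIV. \<Sum>b\<in>{b \<in> ?B. ?g b = h}. 1)" by simp
  also have "\<dots> = (\<Sum>b\<in>?B. 1)" using fin_C by (intro sum.group) (auto simp: fin)
  finally have "agents_here (observe C lab ori cfg a) = Suc (card ?B)"
    by (simp add: agents_here_def)
  also have "\<dots> = card (insert a ?B)" using fin_C by simp
  also have "insert a ?B = {b \<in> C. node (cfg b) = node (cfg a)}" using assms by auto
  finally show ?thesis .
qed

lemma all_here:
  assumes "a \<in> C"
  shows "agents_here (observe C lab ori cfg a) = k \<longleftrightarrow> (\<forall>b\<in>C. node (cfg b) = node (cfg a))"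
proof -
  have "card {b \<in> C. node (cfg b) = node (cfg a)} = card C \<longleftrightarrow>
      {b \<in> C. node (cfg b) = node (cfg a)} = C"
    using fin_C by (metis (no_types, lifting) card_subset_eq mem_Collect_eq subsetI)
  then show ?thesis using assms by (auto simp: agents_here_observe card_C)
qed

lemma tracks_not_over: "tracks t cfg a p m \<Longrightarrow> state (cfg a) \<noteq> over"
  by (auto simp: tracks_def)

lemma terminal_P: "terminal P = over"
  by (simp add: gathering_protocol_def)

lemma decision_tracks:
  assumes "tracks t cfg a p m"
  shows "decision P C lab ori cfg a =
     (if stops knows_n known_value t (view (lift a) m)
           (agents_here (observe C lab ori cfg a)) (crossed (cfg a))
      then (over, None)
      else (live (Suc t) (view (lift a) m), heading knows_n known_value t (view (lift a) m)))"
  using assms by (auto simp: tracks_def decision_def gathering_protocol_def observe_def Let_def)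

lemma port_of_hand:
  assumes "a \<in> C"
  shows "port_of lab (ori a) (loc p) Left = L" "port_of lab (ori a) (loc p) Right = opposite L"
  using hand[OF assms loc_less, of p] by (cases L; simp add: port_of_def)+

lemma opposite_neq: "opposite L \<noteq> L"
  by (cases L) auto

lemma opposite_opposite: "opposite (opposite L) = L"
  by (cases L) auto

section \<open>One round of a single agent\<close>

lemma tracks_nil:
  assumes "a \<in> C" "tracks t cfg a p m"
    and "decision P C lab ori cfg a = (live (Suc t) (view (lift a) m), None)"
  shows "tracks (Suc t) (step P n C lab ori e cfg) a p m"
  using assms
  by (auto simp: tracks_def step_def chosen_port_def observe_def extended_log_def Let_def)

lemma leaves_left:
  assumes "a \<in> C" "node (cfg a) = loc p" "decision P C lab ori cfg a = (s, Some Left)"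
  shows "leaves P n C lab ori e cfg a q \<longleftrightarrow> q = L \<and> e \<noteq> Some (link p)"
  using assms port_of_hand[of a p] by (auto simp: leaves_def chosen_port_def link_def)

lemma leaves_right:
  assumes "a \<in> C" "node (cfg a) = loc p" "decision P C lab ori cfg a = (s, Some Right)"
  shows "leaves P n C lab ori e cfg a q \<longleftrightarrow> q = opposite L \<and> e \<noteq> Some (link (p - 1))"
  using assms port_of_hand[of a p] by (auto simp: leaves_def chosen_port_def link_right)

lemma step_left:
  assumes "a \<in> C" "node (cfg a) = loc p" "decision P C lab ori cfg a = (s, Some Left)"
  shows "step P n C lab ori e cfg a =
    (if e = Some (link p)
     then \<lparr> node = loc p, spot = Outgoing L, crossed = False, state = s \<rparr>
     else \<lparr> node = loc (p + 1), spot = Incoming (opposite L),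
            crossed = (\<exists>b\<in>C. leaves P n C lab ori e cfg b (opposite L) \<and>
                        edge_at n (node (cfg b)) (opposite L) = link p),
            state = s \<rparr>)"
  using assms leaves_left[OF assms, of e] port_of_hand[of a p] neighbour_left[of p]
  by (auto simp: step_def chosen_port_def Let_def link_def)

lemma step_right:
  assumes "a \<in> C" "node (cfg a) = loc p" "decision P C lab ori cfg a = (s, Some Right)"
  shows "step P n C lab ori e cfg a =
    (if e = Some (link (p - 1))
     then \<lparr> node = loc p, spot = Outgoing (opposite L), crossed = False, state = s \<rparr>
     else \<lparr> node = loc (p - 1), spot = Incoming L,
            crossed = (\<exists>b\<in>C. leaves P n C lab ori e cfg b L \<and>
                        edge_at n (node (cfg b)) L = link (p - 1)),
            state = s \<rparr>)"
  using assms leaves_right[OF assms, of e] port_of_hand[of a p] neighbour_right[of p] link_right[of p]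
  by (auto simp: step_def chosen_port_def Let_def opposite_opposite)

text \<open>Assumption \<open>p\<close> asks for equal nodes, not equal integers: in the last phase
  a group shares one position, while the logs of its members may differ by full turns.\<close>

lemma tracks_left:
  assumes a: "a \<in> C" and tr: "tracks t cfg a p m"
    and d: "decision P C lab ori cfg a = (live (Suc t) (view (lift a) m), Some Left)"
    and p: "loc (lift a + int m) = loc p"
  shows "tracks (Suc t) (step P n C lab ori e cfg) a
     (p + (if e = Some (link p) then 0 else 1)) (m + (if e = Some (link p) then 0 else 1))"
proof -
  have "node (cfg a) = loc p" using tr by (simp add: tracks_def)
  note st = step_left[OF a this d, of e]
  have "loc (lift a + 1 + int m) = loc (p + 1)" using p by (simp add: loc_eq_iff algebra_simps)
  then show ?thesis
    using st hand[OF a loc_less] opposite_neq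
    by (auto simp: tracks_def extended_log_def observe_def view_Suc)
qed

lemma tracks_right:
  assumes a: "a \<in> C" and tr: "tracks t cfg a p m"
    and d: "decision P C lab ori cfg a = (live (Suc t) (view (lift a) m), Some Right)"
  shows "tracks (Suc t) (step P n C lab ori e cfg) a
     (p - (if e = Some (link (p - 1)) then 0 else 1)) m"
proof -
  have "node (cfg a) = loc p" using tr by (simp add: tracks_def)
  note st = step_right[OF a this d, of e]
  show ?thesis
    using st hand[OF a loc_less]
    by (auto simp: tracks_def extended_log_def observe_def)
qed

text \<open>The common stopping condition up to round \<open>5 * n\<close>: with \<open>k\<close>
  known a meeting of all agents counts at once, with \<open>n\<close> known from round
  \<open>3 * n\<close> on.\<close>

definition halt :: "nat \<Rightarrow> bool" where
  "halt t \<longleftrightarrow> colocated t \<and> (knows_n \<longrightarrow> 3 * n \<le> t)"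

lemma stops_learnt:
  assumes "a \<in> C" "n \<le> m"
  shows "stops knows_n known_value t (view (lift a) m) c x \<longleftrightarrow>
     \<not> knows_n \<and> c = k \<or> 3 * n \<le> t \<and> c = k \<or> 5 * n < t \<and> x \<or> 6 * n \<le> t"
proof -
  have "take n (view (lift a) m) = view (lift a) n" using assms by (simp add: take_view min_def)
  then show ?thesis
    using learnt_size_view[OF assms] extent_ge[OF assms(2), of "lift a"]
    by (auto simp: stops_def Let_def count_view known_value_def)
qed

lemma heading_learnt:
  assumes "a \<in> C" "n \<le> m"
  shows "heading knows_n known_value t (view (lift a) m) =
     (if 3 * n \<le> t \<and> target (lift a + int m) then if t < 5 * n then None else Some Right
      else Some Left)"
  using learnt_size_view[OF assms] extent_ge[OF assms(2), of "lift a"]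
  by (simp add: heading_def Let_def at_target_view[OF assms(2)])

text \<open>An agent with a full tour knows how many agents to count. One still without it in round
  \<open>3 * n\<close> shows, by \<open>tour\<close>, that all agents share a node.\<close>

lemma stops_early:
  assumes a: "a \<in> C" and t: "t \<le> 5 * n" and no: "\<And>s. s < t \<Longrightarrow> \<not> halt s"
    and c: "c = k \<longleftrightarrow> colocated t"
  shows "stops knows_n known_value t (view (lift a) (moves t a)) c x \<longleftrightarrow> halt t"
proof (cases "n \<le> moves t a")
  case True
  then show ?thesis using t n_pos c by (auto simp: stops_learnt[OF a True] halt_def)
next
  case False
  have 1: "stops knows_n known_value t (view (lift a) (moves t a)) c x \<longleftrightarrow>
      (if knows_n then 3 * n \<le> t else c = k)"
    using extent_less[OF a, of "moves t a"] False
    by (auto simp: stops_def Let_def known_value_def)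
  \<comment> \<open>Here \<open>halt (3 * n)\<close> follows, and no earlier round may satisfy
    \<open>halt\<close>, so \<open>t\<close> is exactly \<open>3 * n\<close>.\<close>
  have "colocated t" if "3 * n \<le> t"
  proof -
    have "colocated (3 * n)" using tour[OF _ a that] False by blast
    then have "halt (3 * n)" by (simp add: halt_def)
    then show ?thesis using no[of "3 * n"] that \<open>colocated (3 * n)\<close> by (cases "t = 3 * n") auto
  qed
  then show ?thesis using 1 c by (auto simp: halt_def)
qed

lemma heading_early:
  assumes a: "a \<in> C" and no: "\<And>s. s \<le> t \<Longrightarrow> \<not> halt s" and t: "t < 5 * n"
  shows "heading knows_n known_value t (view (lift a) (moves t a)) =
     (if 3 * n \<le> t \<and> target (pos t a) then None else Some Left)"
proof (cases "n \<le> moves t a")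
  case True
  then show ?thesis using t by (simp add: heading_learnt[OF a True] pos_def)
next
  case False
  have "\<not> 3 * n \<le> t"
  proof
    assume "3 * n \<le> t"
    then show False using tour[OF _ a, of t] no[of "3 * n"] False by (auto simp: halt_def)
  qed
  then show ?thesis
    using extent_less[OF a, of "moves t a"] False by (simp add: heading_def Let_def)
qed

abbreviation R :: "nat \<Rightarrow> nat \<Rightarrow> nat agent" where
  "R \<equiv> run P known_value n C lab ori sched"

lemma all_here_early:
  assumes "a \<in> C" "\<forall>b\<in>C. tracks t (R t) b (pos t b) (moves t b)"
  shows "agents_here (observe C lab ori (R t) a) = k \<longleftrightarrow> colocated t"
proof -
  have "node (R t b) = loc (pos t b)" if "b \<in> C" for b
    using assms(2) that by (simp add: tracks_def)
  moreover have "(\<forall>b\<in>C. loc (pos t b) = loc (pos t a)) \<longleftrightarrow> colocated t"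
    unfolding colocated_def using assms(1) by metis
  ultimately show ?thesis unfolding all_here[OF assms(1)] using assms(1) by simp
qed

text \<open>Replaces the execution by the recursion \<open>moves\<close>, to which the counting
  arguments apply.\<close>

lemma simulation:
  assumes "t \<le> 5 * n" and "\<And>s. s < t \<Longrightarrow> \<not> halt s"
  shows "\<forall>a\<in>C. tracks t (R t) a (pos t a) (moves t a)"
  using assms
proof (induction t)
  case 0
  have "a < n" if "a \<in> C" for a using C_sub that by auto
  then show ?case
    by (auto simp: tracks_def pos_def loc_lift gathering_protocol_def extended_log_def observe_def)
next
  case (Suc t)
  then have IH: "\<forall>a\<in>C. tracks t (R t) a (pos t a) (moves t a)" by simp
  show ?case
  proof
    fix a assume a: "a \<in> C"
    note tr = IH[rule_format, OF a]
    have no: "\<not> halt s" if "s \<le> t" for s using Suc.prems(2) that by simp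
    have "\<not> stops knows_n known_value t (view (lift a) (moves t a))
       (agents_here (observe C lab ori (R t) a)) (crossed (R t a))"
      using stops_early[OF a, of t] no all_here_early[OF a IH] Suc.prems(1) by simp
    then have d: "decision P C lab ori (R t) a = (live (Suc t) (view (lift a) (moves t a)),
        if 3 * n \<le> t \<and> target (pos t a) then None else Some Left)"
      using decision_tracks[OF tr] heading_early[OF a, of t] no Suc.prems(1) by simp
    show "tracks (Suc t) (R (Suc t)) a (pos (Suc t) a) (moves (Suc t) a)"
    proof (cases "3 * n \<le> t \<and> target (pos t a)")
      case True
      then show ?thesis using tracks_nil[OF a tr] d by (simp add: pos_Suc moves_Suc)
    next
      case False
      have "tracks (Suc t) (R (Suc t)) a
          (pos t a + (if sched t = Some (link (pos t a)) then 0 else 1))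
          (moves t a + (if sched t = Some (link (pos t a)) then 0 else 1))"
        using tracks_left[OF a tr, of "sched t"] d False by (auto simp: pos_def)
      then show ?thesis using False by (auto simp: pos_Suc moves_Suc)
    qed
  qed
qed

section \<open>Two groups approaching each other\<close>

text \<open>All agents decide to stop in the same round, none having stopped earlier; awareness is
  derived from this.\<close>

definition finished :: "nat \<Rightarrow> bool" where
  "finished t \<longleftrightarrow> gathered n C (R t) \<and>
     (\<forall>a\<in>C. state (R t a) \<noteq> over \<and> decision P C lab ori (R t) a = (over, None))"

text \<open>\<open>gathered\<close> orders the two nodes clockwise; which of them comes first
  depends on \<open>L\<close>.\<close>

lemma gathered_adjacent:
  assumes "\<And>a. a \<in> C \<Longrightarrow> node (cfg a) = loc p \<or> node (cfg a) = loc (p + 1)"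
  shows "gathered n C cfg"
proof -
  have "loc (p + 1) = (loc p + 1) mod n \<or> loc p = (loc (p + 1) + 1) mod n"
    using neighbour_left[of p] neighbour_right[of "p + 1"] by (cases "L = QPlus"; cases L) auto
  then show ?thesis
    unfolding gathered_def using assms loc_less by metis
qed

text \<open>
  The group that missed the target is at \<open>s\<close> and moves left, the group that waited at the target is
  at \<open>s + d\<close> and moves right; \<open>r\<close> is the target. The value \<open>d = - 1\<close> means that they have just
  crossed. The bound \<open>s + d \<le> r\<close> keeps the first group from mistaking itself for the second.
\<close>

definition closing :: "int \<Rightarrow> nat \<Rightarrow> int \<Rightarrow> int \<Rightarrow> bool" where
  "closing r t s d \<longleftrightarrow>
     - 1 \<le> d \<and> d < int n \<and> (d = - 1 \<longrightarrow> 5 * n < t) \<and> (d \<le> 1 \<or> d + int t < 6 * int n) \<and>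
     r - int n < s \<and> s + d \<le> r \<and>
     (\<forall>a\<in>C. \<exists>m\<ge>n.
        if target (pos (5 * n) a) then target (lift a + int m) \<and> tracks t (R t) a (s + d) m
        else loc (lift a + int m) = loc s \<and> tracks t (R t) a s m) \<and>
     (5 * n < t \<longrightarrow> (\<forall>a\<in>C. crossed (R t a) \<longleftrightarrow> d = - 1))"

text \<open>Both groups are inhabited, so a full headcount means that they met, and each side has a
  partner to cross.\<close>

context
  fixes a0 b0 :: nat and r :: int
  assumes a0: "a0 \<in> C" "\<not> target (pos (5 * n) a0)"
    and b0: "b0 \<in> C" "target (pos (5 * n) b0)"
    and r: "target r"
begin

text \<open>On a single node every position would be the target. The bound ensures that
  \<open>d = - 1\<close> is not a multiple of \<open>n\<close>.\<close>

lemma two_le_n: "2 \<le> n"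
proof (rule ccontr)
  assume "\<not> 2 \<le> n"
  then have "n = 1" using n_pos by simp
  then have "int n dvd pos (5 * n) a0 - pos (5 * n) b0" by simp
  then show False using target_cong a0 b0 by blast
qed

lemma small_dvd: "- 1 \<le> d \<Longrightarrow> d < int n \<Longrightarrow> int n dvd d \<longleftrightarrow> d = 0"
proof -
  assume "- 1 \<le> d" "d < int n"
  then consider "d = - 1" | "d = 0" | "0 < d" by linarith
  then show ?thesis
    using two_le_n \<open>d < int n\<close> zdvd_not_zless[of d "int n"] by cases auto
qed

lemma node_closing:
  assumes "closing r t s d" "a \<in> C"
  shows "node (R t a) = (if target (pos (5 * n) a) then loc (s + d) else loc s)"
  using assms by (fastforce simp: closing_def tracks_def)

text \<open>\<open>d = 0\<close> is seen as a full headcount and \<open>d = - 1\<close> as a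
  crossing; from round \<open>6 * n\<close> on the clock decides.\<close>

lemma stops_closing:
  assumes cl: "closing r t s d" and t: "5 * n \<le> t" and a: "a \<in> C" and m: "n \<le> m"
  shows "stops knows_n known_value t (view (lift a) m)
     (agents_here (observe C lab ori (R t) a)) (crossed (R t a)) \<longleftrightarrow> d \<le> 0 \<or> 6 * n \<le> t"
proof -
  have node: "node (R t b) = (if target (pos (5 * n) b) then loc (s + d) else loc s)"
    if "b \<in> C" for b
    using node_closing[OF cl that] .
  have "loc (s + d) = loc s \<longleftrightarrow> d = 0"
    using cl small_dvd[of d] by (simp add: closing_def loc_eq_iff)
  then have "agents_here (observe C lab ori (R t) a) = k \<longleftrightarrow> d = 0"
    unfolding all_here[OF a] using node a a0 b0 by (auto split: if_splits)
  then show ?thesis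
    using cl t a unfolding stops_learnt[OF a m] closing_def by auto
qed

lemma closing_finished:
  assumes cl: "closing r t s d" and t: "5 * n \<le> t" and fin: "d \<le> 0 \<or> 6 * n \<le> t"
  shows "finished t"
proof -
  have "state (R t a) \<noteq> over \<and> decision P C lab ori (R t) a = (over, None)" if a: "a \<in> C" for a
  proof -
    obtain m p where m: "n \<le> m" and tr: "tracks t (R t) a p m"
      using cl a unfolding closing_def by meson
    show ?thesis
      using tracks_not_over[OF tr] decision_tracks[OF tr] stops_closing[OF cl t a m] fin by simp
  qed
  moreover have "gathered n C (R t)"
  proof -
    \<comment> \<open>From round \<open>6 * n\<close> on, the invariant leaves only
      \<open>d \<le> 1\<close>.\<close>
    have d: "d = 0 \<or> d = 1 \<or> d = - 1" using cl fin by (auto simp: closing_def)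
    have "node (R t a) = loc s \<or> node (R t a) = loc (s + d)" if "a \<in> C" for a
      using node_closing[OF cl that] by simp
    moreover have "gathered n C (R t)"
      if "\<And>a. a \<in> C \<Longrightarrow> node (R t a) = loc s \<or> node (R t a) = loc (s - 1)"
      using that by (intro gathered_adjacent[of "R t" "s - 1"]) auto
    ultimately show ?thesis using d gathered_adjacent[of "R t" s] by auto
  qed
  ultimately show ?thesis by (simp add: finished_def)
qed

text \<open>For \<open>1 < d\<close> the groups face different edges, so \<open>d\<close> falls and
  \<open>d + int t\<close> does not grow. For \<open>d = 1\<close> they face the same edge: if it is
  missing, \<open>d\<close> stays 1, otherwise they cross and \<open>d\<close> becomes
  \<open>- 1\<close>.\<close>

lemma closing_step:
  assumes cl: "closing r t s d" and t: "5 * n \<le> t" and d: "0 < d" and t6: "t < 6 * n"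
  shows "\<exists>s d. closing r (Suc t) s d"
proof -
  let ?G = "\<lambda>a. target (pos (5 * n) a)"
  define bs br where "bs \<longleftrightarrow> sched t = Some (link s)" and "br \<longleftrightarrow> sched t = Some (link (s + d - 1))"
  define s' where "s' = s + (if bs then 0 else 1)"
  define d' where "d' = s + d - (if br then 0 else 1) - s'"
  have dn: "d < int n" and s: "r - int n < s" "s + d \<le> r" and bound: "d \<le> 1 \<or> d + int t < 6 * int n"
    using cl by (auto simp: closing_def)
  \<comment> \<open>\<open>s\<close> lies strictly between the consecutive copies
    \<open>r - int n\<close> and \<open>r\<close> of the target.\<close>
  have ns: "\<not> target s"
  proof
    assume "target s"
    then have "int n dvd r - s" using target_unique r by blast
    then show False using s d zdvd_not_zless[of "r - s" "int n"] by simp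
  qed
  have same: "link (s + d - 1) = link s \<longleftrightarrow> d = 1"
    using small_dvd[of "d - 1"] d dn by (simp add: link_eq_iff)
  have nodes: "node (R t a) = (if ?G a then loc (s + d) else loc s)" if "a \<in> C" for a
    using node_closing[OF cl that] .
  have dec: "\<exists>m\<ge>n. decision P C lab ori (R t) a =
        (live (Suc t) (view (lift a) m), Some (if ?G a then Right else Left)) \<and>
      (if ?G a then target (lift a + int m) \<and> tracks t (R t) a (s + d) m
       else loc (lift a + int m) = loc s \<and> tracks t (R t) a s m)" if a: "a \<in> C" for a
  proof -
    obtain m where m: "n \<le> m"
      and trs: "if ?G a then target (lift a + int m) \<and> tracks t (R t) a (s + d) m
       else loc (lift a + int m) = loc s \<and> tracks t (R t) a s m"
      using cl a unfolding closing_def by blast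
    \<comment> \<open>The log of the right-moving group still ends at the target, since right moves
      are not logged; that of the other group ends at \<open>s\<close>. So both keep their
      direction.\<close>
    have "target (lift a + int m) \<longleftrightarrow> ?G a"
      using trs ns target_cong[of "lift a + int m" s] by (auto simp: loc_eq_iff split: if_splits)
    then have "heading knows_n known_value t (view (lift a) m) = Some (if ?G a then Right else Left)"
      using t by (simp add: heading_learnt[OF a m])
    moreover obtain p where tr: "tracks t (R t) a p m" using trs by (auto split: if_splits)
    ultimately show ?thesis
      using decision_tracks[OF tr] stops_closing[OF cl t a m] d t6 m trs by auto
  qed
  have leave: "leaves P n C lab ori (sched t) (R t) a q \<longleftrightarrow>
      (if ?G a then q = opposite L \<and> \<not> br else q = L \<and> \<not> bs)" if a: "a \<in> C" for a q
    using dec[OF a] nodes[OF a] leaves_left[OF a] leaves_right[OF a]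
    by (auto simp: bs_def br_def)
  have trk: "\<exists>m\<ge>n. if ?G a then target (lift a + int m) \<and> tracks (Suc t) (R (Suc t)) a (s' + d') m
        else loc (lift a + int m) = loc s' \<and> tracks (Suc t) (R (Suc t)) a s' m"
    if a: "a \<in> C" for a
  proof -
    obtain m where m: "n \<le> m" "decision P C lab ori (R t) a =
        (live (Suc t) (view (lift a) m), Some (if ?G a then Right else Left))"
      "if ?G a then target (lift a + int m) \<and> tracks t (R t) a (s + d) m
       else loc (lift a + int m) = loc s \<and> tracks t (R t) a s m" using dec[OF a] by blast
    show ?thesis
    proof (cases "?G a")
      case True
      have eq: "s' + d' = s + d - (if sched t = Some (link (s + d - 1)) then 0 else 1)"
        by (simp add: d'_def br_def)
      have "tracks (Suc t) (R (Suc t)) a (s' + d') m"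
        unfolding eq run.simps by (rule tracks_right[OF a]) (use m True in auto)
      then show ?thesis using True m by auto
    next
      case False
      let ?m = "m + (if bs then 0 else 1)"
      have "tracks (Suc t) (R (Suc t)) a s' ?m"
        using tracks_left[OF a, of t "R t" s m "sched t"] m False
        by (simp add: s'_def bs_def)
      moreover have "loc (lift a + int ?m) = loc s'"
        using m False loc_cong[of "lift a + int m" s 1] by (auto simp: s'_def loc_eq_iff add.assoc)
      ultimately show ?thesis using False m(1) by (intro exI[of _ ?m]) auto
    qed
  qed
  have cross: "crossed (R (Suc t) a) \<longleftrightarrow> d = 1 \<and> \<not> bs \<and> \<not> br" if a: "a \<in> C" for a
  proof (cases "?G a")
    case True
    obtain st where st: "decision P C lab ori (R t) a = (st, Some Right)"
      using dec[OF a] True by auto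
    have "(\<exists>b\<in>C. leaves P n C lab ori (sched t) (R t) b L \<and>
        edge_at n (node (R t b)) L = link (s + d - 1)) \<longleftrightarrow> \<not> bs \<and> d = 1"
      using same a0 leave nodes opposite_neq by (auto simp: link_def[symmetric] split: if_splits)
    then show ?thesis
      using step_right[OF a _ st, of "s + d" "sched t"] nodes[OF a] True by (auto simp: br_def)
  next
    case False
    obtain st where st: "decision P C lab ori (R t) a = (st, Some Left)"
      using dec[OF a] False by auto
    have "(\<exists>b\<in>C. leaves P n C lab ori (sched t) (R t) b (opposite L) \<and>
        edge_at n (node (R t b)) (opposite L) = link s) \<longleftrightarrow> \<not> br \<and> d = 1"
      using same b0 leave nodes opposite_neq by (auto simp: link_right split: if_splits)
    then show ?thesis
      using step_left[OF a _ st, of "s" "sched t"] nodes[OF a] False by (auto simp: bs_def)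
  qed
  have "bs \<longleftrightarrow> br" if "d = 1" using same that by (simp add: bs_def br_def)
  moreover have "\<not> (bs \<and> br)" if "d \<noteq> 1" using same that by (auto simp: bs_def br_def)
  ultimately have "d' = - 1 \<longleftrightarrow> d = 1 \<and> \<not> bs \<and> \<not> br" "- 1 \<le> d'" "d' \<le> 1 \<or> d' < d" "d' \<le> d"
    using d by (auto simp: d'_def s'_def)
  then have "closing r (Suc t) s' d'"
    unfolding closing_def using trk cross bound dn s t by (auto simp: s'_def d'_def)
  then show ?thesis by blast
qed

lemma third_stage:
  assumes "closing r (5 * n) s d"
  shows "\<exists>t\<le>6 * n. finished t"
proof (rule ccontr)
  assume no: "\<not> ?thesis"
  have "5 * n \<le> t \<Longrightarrow> t \<le> 6 * n \<Longrightarrow> \<exists>s d. closing r t s d" for t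
  proof (induction t rule: dec_induct)
    case base
    then show ?case using assms by blast
  next
    case (step t)
    then obtain s d where cl: "closing r t s d" by auto
    have t: "5 * n \<le> t" "t < 6 * n" using step by auto
    then have "0 < d" using closing_finished[OF cl t(1)] no by fastforce
    then show ?case using closing_step[OF cl t(1) _ t(2)] by blast
  qed
  from this[of "6 * n"] obtain s d where "closing r (6 * n) s d" by auto
  then have "finished (6 * n)" using closing_finished by simp
  then show False using no by blast
qed

end

section \<open>Termination and awareness\<close>

lemma finishes: "\<exists>t\<le>6 * n. finished t"
proof (cases "\<exists>s\<le>5 * n. halt s")
  case True
  \<comment> \<open>The first such round is taken so that \<open>simulation\<close> applies up to
    it.\<close>
  define t where "t = (LEAST s. halt s)"
  have t: "halt t" "t \<le> 5 * n"
    using True LeastI[of halt] Least_le[of halt] unfolding t_def by (metis, metis le_trans)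
  have no: "\<And>s. s < t \<Longrightarrow> \<not> halt s" using not_less_Least by (auto simp: t_def)
  have sim: "\<forall>a\<in>C. tracks t (R t) a (pos t a) (moves t a)"
    using simulation[OF t(2)] no by blast
  obtain c where c: "c \<in> C" using C_nonempty by blast
  have "gathered n C (R t)"
  proof (rule gathered_adjacent)
    fix a assume a: "a \<in> C"
    then have "node (R t a) = loc (pos t a)" using sim by (simp add: tracks_def)
    also have "\<dots> = loc (pos t c)" using t(1) a c unfolding halt_def colocated_def by blast
    finally show "node (R t a) = loc (pos t c) \<or> node (R t a) = loc (pos t c + 1)" by simp
  qed
  moreover have "decision P C lab ori (R t) a = (over, None)" if a: "a \<in> C" for a
    using decision_tracks[OF sim[rule_format, OF a]]
      stops_early[OF a t(2) no all_here_early[OF a sim]] t(1) by simp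
  ultimately have "finished t"
    using tracks_not_over sim by (auto simp: finished_def)
  then show ?thesis using t(2) by (intro exI[of _ t]) auto
next
  case False
  then have no: "\<And>s. s \<le> 5 * n \<Longrightarrow> \<not> halt s" by blast
  then have sim: "\<forall>a\<in>C. tracks (5 * n) (R (5 * n)) a (pos (5 * n) a) (moves (5 * n) a)"
    by (intro simulation) auto
  have nc: "\<not> colocated (3 * n)" "\<not> colocated (5 * n)"
    using no[of "3 * n"] no[of "5 * n"] by (auto simp: halt_def)
  have learnt: "n \<le> moves (5 * n) a" if "a \<in> C" for a using tour[OF nc(1) that] by simp
  \<comment> \<open>Were all agents at the target, or none, they would share a node, by
    \<open>target_unique\<close> and \<open>two_groups\<close> respectively.\<close>
  obtain a0 where a0: "a0 \<in> C" "\<not> target (pos (5 * n) a0)"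
    using nc(2) target_unique by (auto simp: colocated_def loc_eq_iff)
  obtain b0 where b0: "b0 \<in> C" "target (pos (5 * n) b0)"
    using nc(2) two_groups by (auto simp: colocated_def loc_eq_iff)
  define r where "r = pos (5 * n) b0"
  \<comment> \<open>\<open>i\<close> is the number of left moves from the first group to the target
    and becomes the initial \<open>d\<close>; \<open>i < n\<close> gives
    \<open>d + 5 * n < 6 * n\<close>.\<close>
  obtain i where i: "i < n" "int n dvd (pos (5 * n) a0 + int i) - r" using residue_offset by blast
  have i0: "i \<noteq> 0"
  proof
    assume "i = 0"
    then show False using i target_cong a0 b0 by (auto simp: r_def)
  qed
  have "if target (pos (5 * n) a)
      then target (lift a + int (moves (5 * n) a)) \<and>
        tracks (5 * n) (R (5 * n)) a (r - int i + int i) (moves (5 * n) a)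
      else loc (lift a + int (moves (5 * n) a)) = loc (r - int i) \<and>
        tracks (5 * n) (R (5 * n)) a (r - int i) (moves (5 * n) a)" if a: "a \<in> C" for a
  proof (cases "target (pos (5 * n) a)")
    case True
    then have "loc (pos (5 * n) a) = loc r"
      using target_unique b0 by (simp add: r_def loc_eq_iff)
    then show ?thesis using True sim a by (simp add: tracks_def pos_def)
  next
    case False
    have "loc (pos (5 * n) a) = loc (pos (5 * n) a0)"
      using two_groups[OF False a0(2)] by (simp add: loc_eq_iff)
    also have "\<dots> = loc (r - int i)" using i by (simp add: loc_eq_iff algebra_simps)
    finally show ?thesis using False sim a by (simp add: tracks_def pos_def)
  qed
  then have "\<forall>a\<in>C. \<exists>m\<ge>n.
      if target (pos (5 * n) a)
      then target (lift a + int m) \<and> tracks (5 * n) (R (5 * n)) a (r - int i + int i) m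
      else loc (lift a + int m) = loc (r - int i) \<and> tracks (5 * n) (R (5 * n)) a (r - int i) m"
    using learnt by blast
  then have "closing r (5 * n) (r - int i) (int i)"
    unfolding closing_def using i i0 by simp
  then show ?thesis using third_stage[OF a0 b0, of r] b0 by (auto simp: r_def)
qed

lemma run_after_finished:
  assumes fin: "finished t" and a: "a \<in> C" and u: "t < u"
  shows "state (R u a) = over \<and> node (R u a) = node (R t a)"
proof -
  have "Suc t \<le> u" using u by simp
  then show ?thesis
  proof (induction u rule: dec_induct)
    case base
    then show ?case
      using fin a by (simp add: finished_def step_def chosen_port_def Let_def)
  next
    case (step u)
    then have "decision P C lab ori (R u) a = (over, None)"
      by (simp add: decision_def terminal_P)
    then show ?case using step by (simp add: step_def chosen_port_def Let_def)
  qed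
qed

lemma over_persists: "s \<le> t \<Longrightarrow> state (R s a) = over \<Longrightarrow> state (R t a) = over"
proof (induction t rule: dec_induct)
  case (step t)
  then show ?case by (simp add: step_def chosen_port_def Let_def decision_def terminal_P)
qed

text \<open>The extra round is the one in which the decision takes effect. Terminal states persist
  and none occurs at \<open>t\<close>, so a terminal agent is found only later, when nobody moves
  any more.\<close>

lemma achieves: "achieves_gathering_within P n C R (6 * n + 1)"
proof -
  obtain t where t: "t \<le> 6 * n" "finished t" using finishes by blast
  have gath: "gathered n C (R u)" if "t < u" for u
    using t(2) run_after_finished[OF t(2) _ that] by (simp add: finished_def gathered_def)
  have "t < u" if "a \<in> C" "state (R u a) = over" for u a
    using over_persists[OF _ that(2), of t] that(1) t(2) by (force simp: finished_def not_less[symmetric])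
  then show ?thesis
    unfolding achieves_gathering_within_def terminal_P
    using gath run_after_finished[OF t(2), of _ "Suc t"] t(1)
    by (auto intro!: exI[of _ "Suc t"])
qed

end

section \<open>From the model's assumptions to the theorem\<close>

lemma common_left_port:
  assumes ori: "\<forall>a\<in>C. private_orientation n lab (ori a)"
    and ch: "chirality n C lab ori"
  shows "\<exists>L. \<forall>a\<in>C. \<forall>i<n. \<forall>q. hand_of lab (ori a) i q = (if q = L then Left else Right)"
proof (cases "C = {} \<or> n = 0")
  case True
  then show ?thesis by auto
next
  case False
  then obtain c where c: "c \<in> C" "0 < n" by auto
  \<comment> \<open>Chirality passes from agent to agent, consistency of an orientation from node to
    node.\<close>
  have all: "hand_of lab (ori a) i q = hand_of lab (ori c) 0 q" if "a \<in> C" "i < n" for a i q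
  proof -
    have "hand_of lab (ori a) i q = hand_of lab (ori c) i q"
      using ch that c unfolding chirality_def by blast
    also have "\<dots> = hand_of lab (ori c) 0 q"
      using ori that c unfolding private_orientation_def hand_of_def by blast
    finally show ?thesis .
  qed
  have neq: "hand_of lab (ori c) 0 QMinus \<noteq> hand_of lab (ori c) 0 QPlus"
    using ori c unfolding private_orientation_def hand_of_def by blast
  have "hand_of lab (ori a) i q =
      (if q = (if hand_of lab (ori c) 0 QMinus = Left then QMinus else QPlus) then Left else Right)"
    if "a \<in> C" "i < n" for a i q
    using all[OF that, of q] neq
    by (cases q; cases "hand_of lab (ori c) 0 QMinus"; cases "hand_of lab (ori c) 0 QPlus") auto
  then show ?thesis by blast
qed

theorem theorem3:
  fixes known :: "nat \<Rightarrow> nat \<Rightarrow> nat"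
  assumes "known = (\<lambda>n k. n) \<or> known = (\<lambda>n k. k)"
  shows "\<exists>(P :: nat protocol) (T :: nat \<Rightarrow> nat).
           (\<lambda>n. real (T n)) \<in> O(\<lambda>n. real n) \<and>
           (\<forall>n k C. 1 \<le> k \<longrightarrow> C \<in> configurations n k - periodic_configurations n k \<longrightarrow>
              solves_gathering_chirality_cross P (known n k) n C (T n))"
proof -
  obtain knows_n where known: "known n k = (if knows_n then n else k)" for n k
    using assms by (metis (full_types))
  have "(\<lambda>n. real (6 * n + 1)) \<in> O(\<lambda>n. real n)"
    \<comment> \<open>\<open>6 * n + 1 \<le> 7 * n\<close> from \<open>n = 1\<close> on.\<close>
    by (intro bigoI[of _ 7] eventually_sequentiallyI[of 1]) simp
  moreover have "solves_gathering_chirality_cross (gathering_protocol knows_n)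
      (known n k) n C (6 * n + 1)"
    if k: "1 \<le> k" and C: "C \<in> configurations n k - periodic_configurations n k" for n k C
    unfolding solves_gathering_chirality_cross_def
  proof (intro allI impI, elim conjE)
    fix lab ori sched
    assume "port_labeling n lab" "\<forall>a\<in>C. private_orientation n lab (ori a)" "chirality n C lab ori"
    then obtain L where hand:
        "\<forall>a\<in>C. \<forall>i<n. \<forall>q. hand_of lab (ori a) i q = (if q = L then Left else Right)"
      using common_left_port by blast
    interpret ring_execution knows_n n k C L lab ori sched
      using k C hand by unfold_locales auto
    show "achieves_gathering_within (gathering_protocol knows_n) n C
        (run (gathering_protocol knows_n) (known n k) n C lab ori sched) (6 * n + 1)"
      using achieves unfolding known known_value_def .
  qed
  ultimately show ?thesis
    by (intro exI[of _ "gathering_protocol knows_n"] exI[of _ "\<lambda>n. 6 * n + 1"]) auto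
qed

end
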